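(* For every integer $n\geq 4$, the $n$-dimensional twisted hypercube $H_n$ satisfies $\kappa(H_{n}; K_{1,3})=\kappa^{s}(H_{n}; K_{1,3})=\lceil\frac{n}{2}\rceil$.
   Context: **Twisted hypercube.** Define an integer function $\kappa$ by $\kappa(1)=0$ and $\kappa(n)=\max\{1,\lceil \log_2 n-2\log_2\log_2 n\rceil\}$ for $n\ge 2$. Let $Z_2^n$ be the set of binary strings $x=x_1x_2\cdots x_n$ of length $n$. For $x\in Z_2^n$ ($n\ge1$), $\phi(x)\in Z_2^n$ is the string with $\phi(x)_j=x_j+x_{n-\kappa(n)+j} \pmod 2$ for $1\le j\le \kappa(n)$ and $\phi(x)_j=x_j$ for $\kappa(n)<j\le n$ ($\phi$ is an involution on $Z_2^n$). The graph $H_1$ is $K_2$ with vertices $0,1$. For $n\ge 2$, $H_n$ has vertex set $Z_2^n$ and is obtained from two copies $0H_{n-1}$ and $1H_{n-1}$ of $H_{n-1}$ (vertices prefixed by $0$ and $1$ respectively) by adding the edges joining $0x$ and $1\phi(x)$ for all $x\in Z_2^{n-1}$. **Structure connectivity.** Let $G$ be a graph and $T$ a connected graph that is isomorphic to a subgraph of $G$. For a set $\mathcal F$ of subgraphs of $G$ (not required to be disjoint), $G-\mathcal F$ is the subgraph of $G$ induced by the vertices belonging to no member of $\mathcal F$. $\mathcal F$ is a $T$-structure-cut if every member is isomorphic to $T$ and $G-\mathcal F$ is disconnected; it is a $T$-substructure-cut if every member is isomorphic to a connected subgraph of $T$ and $G-\mathcal F$ is disconnected. $\kappa(G;T)$ (resp.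 $\kappa^s(G;T)$) is the minimum cardinality of a $T$-structure-cut (resp. $T$-substructure-cut) of $G$. $K_{1,r}$ is the star with $r$ leaves. *)

theory Defs
  imports
    Complex_Main
    "HOL-Library.Extended_Nat"
    "HOL-Library.Z2"
    "Graph_Theory.Graph_Theory"
begin

text \<open>
  Undirected graphs are represented, as in the theories of \<open>Graph_Theory\<close>, by symmetric digraphs
  (locale \<^locale>\<open>pair_graph\<close>: finite, loop-free, symmetric, no parallel arcs).
\<close>

section \<open>Twisted hypercubes\<close>

definition kap :: "nat \<Rightarrow> nat" where
  "kap n = (if n \<le> 1 then 0 else nat (max 1 \<lceil>log 2 (real n) - 2 * log 2 (log 2 (real n))\<rceil>))"

text \<open>Positions are counted from \<open>0\<close> here, so \<open>x ! j\<close> is the letter with index \<open>j + 1\<close> of \<open>x\<close>;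
  the addition is that of the two-element field.\<close>

definition phi :: "bit list \<Rightarrow> bit list" where
  "phi x = (let n = length x in
     map (\<lambda>j. if j < kap n then x ! j + x ! (n - kap n + j) else x ! j) [0..<n])"

text \<open>The value at \<open>0\<close> is irrelevant: the family starts with \<open>K\<^sub>2\<close> at \<open>1\<close>.\<close>

fun twisted_hypercube :: "nat \<Rightarrow> bit list pair_pre_digraph" where
  "twisted_hypercube 0 = \<lparr> pverts = {[]}, parcs = {} \<rparr>"
| "twisted_hypercube (Suc 0) = \<lparr> pverts = {[0], [1]}, parcs = {([0], [1]), ([1], [0])} \<rparr>"
| "twisted_hypercube (Suc (Suc n)) = \<lparr>
     pverts = {x. length x = Suc (Suc n)},
     parcs = {(b # x, b # y) | b x y. (x, y) \<in> parcs (twisted_hypercube (Suc n))}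
       \<union> {(0 # x, 1 # phi x) | x. length x = Suc n}
       \<union> {(1 # phi x, 0 # x) | x. length x = Suc n} \<rparr>"

section \<open>Structure and substructure connectivity\<close>

definition ugraph_subgraph :: "'a pair_pre_digraph \<Rightarrow> 'a pair_pre_digraph \<Rightarrow> bool" where
  "ugraph_subgraph H G \<longleftrightarrow> pair_graph H \<and> subgraph H G"

definition delete_family :: "'a pair_pre_digraph \<Rightarrow> 'a pair_pre_digraph set
    \<Rightarrow> ('a, 'a \<times> 'a) pre_digraph" where
  "delete_family G F = with_proj G \<restriction> (pverts G - (\<Union>H\<in>F. pverts H))"

text \<open>The library's \<^const>\<open>connected\<close> excludes the graph without vertices; that graph is not
  counted as disconnected either.\<close>

definition disconnected_graph :: "('a, 'b) pre_digraph \<Rightarrow> bool" where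
  "disconnected_graph G \<longleftrightarrow> verts G \<noteq> {} \<and> \<not> connected G"

definition structure_cut :: "'a pair_pre_digraph \<Rightarrow> 'b pair_pre_digraph
    \<Rightarrow> 'a pair_pre_digraph set \<Rightarrow> bool" where
  "structure_cut G T F \<longleftrightarrow> finite F
     \<and> (\<forall>H\<in>F. ugraph_subgraph H G \<and> digraph_iso H T)
     \<and> disconnected_graph (delete_family G F)"

definition substructure_cut :: "'a pair_pre_digraph \<Rightarrow> 'b pair_pre_digraph
    \<Rightarrow> 'a pair_pre_digraph set \<Rightarrow> bool" where
  "substructure_cut G T F \<longleftrightarrow> finite F
     \<and> (\<forall>H\<in>F. ugraph_subgraph H G
           \<and> (\<exists>S. ugraph_subgraph S T \<and> connected S \<and> digraph_iso H S))
     \<and> disconnected_graph (delete_family G F)"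

text \<open>The minimum is taken in \<^typ>\<open>enat\<close>: it is \<open>\<infinity>\<close> if there is no cut at all.\<close>

definition structure_connectivity :: "'a pair_pre_digraph \<Rightarrow> 'b pair_pre_digraph \<Rightarrow> enat" where
  "structure_connectivity G T = (INF F \<in> {F. structure_cut G T F}. enat (card F))"

definition substructure_connectivity :: "'a pair_pre_digraph \<Rightarrow> 'b pair_pre_digraph \<Rightarrow> enat" where
  "substructure_connectivity G T = (INF F \<in> {F. substructure_cut G T F}. enat (card F))"

definition star :: "nat \<Rightarrow> nat pair_pre_digraph" where
  "star r = \<lparr> pverts = {0..r}, parcs = {0} \<times> {1..r} \<union> {1..r} \<times> {0} \<rparr>"

lemma complete_bipartite_star: "K\<^bsub>1,r\<^esub> (with_proj (star r))"
  unfolding complete_bipartite_digraph_pair_def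
  by (intro conjI, simp add: star_def)
     (rule exI[of _ "{0}"], rule exI[of _ "{1..r}"], auto simp: star_def)

lemma phi_length [simp]: "length (phi x) = length x"
  by (simp add: phi_def Let_def)

lemma pverts_twisted_hypercube: "pverts (twisted_hypercube n) = {x. length x = n}"
  by (cases n rule: twisted_hypercube.cases) (auto simp: length_Suc_conv)

lemma pair_graph_twisted_hypercube: "pair_graph (twisted_hypercube n)"
proof -
  have fin: "finite {x :: bit list. length x = m}" for m
  proof -
    have "(UNIV :: bit set) = {0, 1}"
      using bit_not_zero_iff by blast
    then have "finite (UNIV :: bit set)"
      by (metis finite.emptyI finite.insertI)
    then show ?thesis
      using finite_lists_length_eq[of "UNIV :: bit set" m] by simp
  qed
  have V: "e \<in> parcs (twisted_hypercube n) \<Longrightarrow>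
      length (fst e) = n \<and> length (snd e) = n \<and> fst e \<noteq> snd e" for e
    by (induction n arbitrary: e rule: twisted_hypercube.induct) fastforce+
  have S: "(x, y) \<in> parcs (twisted_hypercube n) \<Longrightarrow> (y, x) \<in> parcs (twisted_hypercube n)" for x y
    by (induction n arbitrary: x y rule: twisted_hypercube.induct) auto
  have "parcs (twisted_hypercube n) \<subseteq> {x. length x = n} \<times> {x. length x = n}"
    using V by fastforce
  then have "finite (parcs (twisted_hypercube n))"
    by (rule finite_subset) (simp add: fin)
  then show ?thesis
    by unfold_locales
      (use V S in \<open>auto simp: pverts_twisted_hypercube fin symmetric_def intro!: symI\<close>)
qed

end

theory Submission
  imports Defs
begin

text \<open>
  Upper bound: the neighbours of the zero word are the unit words, and since \<open>\<kappa>(m) \<le> m/2\<close> two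
  consecutive unit words have their sum as a common neighbour; the stars centred at these sums
  isolate the zero word.

  Lower bound: give a deleted vertex weight 1 and a deleted star weight 2. Deleting a family of
  weight less than \<open>n\<close> from \<open>H\<^sub>n\<close> leaves a connected graph, by induction on \<open>n\<close>. A star meets
  the half not containing its centre in at most one vertex. Hence either both halves inherit a
  weight less than \<open>n - 1\<close>, so that both stay connected and a surviving matching edge joins them,
  or one half carries the whole weight. In the latter case all centres lie in that half, so every
  deleted vertex of the other half is matched to a deleted one; the other half stays connected
  and every remaining vertex is joined to it.
\<close>

section \<open>The twist: bounds on \<open>kap\<close> and the involution \<open>phi\<close>\<close>

text \<open>This separates the positions that \<open>phi\<close> changes from those it reads. With
  \<open>h = n div 2\<close>, the bound \<open>h < 2 ^ h\<close> gives
  \<open>n \<le> 2 ^ (h + 2)\<close>, so the logarithm is at most \<open>h + 2\<close>, and for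
  \<open>n \<ge> 4\<close> the iterated logarithm takes the surplus 2 away.\<close>

lemma kap_le_half: "2 * kap n \<le> n"
proof (cases "n \<le> 1")
  case True
  then show ?thesis by (simp add: kap_def)
next
  case False
  define h where "h = n div 2"
  have h1: "h \<ge> 1" using False by (simp add: h_def)
  have n_pow: "real n \<le> 2 ^ (h + 2)"
  proof -
    have "n \<le> 2 * h + 1" "h < 2 ^ h" by (simp_all add: h_def)
    then have "n \<le> 4 * 2 ^ h" by linarith
    then have "n \<le> 2 ^ (h + 2)" by (simp add: power_add)
    then show ?thesis by (metis of_nat_le_iff of_nat_numeral of_nat_power)
  qed
  have "log 2 n - 2 * log 2 (log 2 n) \<le> h"
  proof (cases "n \<ge> 4")
    case True
    have "log 2 n \<ge> 2" using True by (simp add: le_log_iff)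
    then have "log 2 (log 2 n) \<ge> 1" by (simp add: le_log_iff)
    moreover have "log 2 n \<le> h + 2"
      using n_pow False by (simp add: log_le_iff powr_realpow[symmetric] powr_add)
    ultimately show ?thesis by simp
  next
    case small: False
    then consider "n = 2" | "n = 3" using False by linarith
    then show ?thesis
    proof cases
      case 1
      then show ?thesis by (simp add: h_def)
    next
      case 2
      \<comment> \<open>For \<open>n = 3\<close> the estimates reduce by squaring to 9 \<ge> 8 and
        9/4 \<ge> 2.\<close>
      have sq: "log 2 (x\<^sup>2) = 2 * log 2 x" if "x > 0" for x :: real
        using that log_nat_power[of x 2 2] by simp
      have "3 \<le> log 2 ((3::real)\<^sup>2)" by (subst le_log_iff) auto
      also note sq
      finally have l1: "log 2 3 \<ge> (3/2::real)" by simp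
      have "1 \<le> log 2 ((3/2::real)\<^sup>2)" by (subst le_log_iff) (auto simp: power2_eq_square)
      also note sq
      finally have "2 * log 2 (3/2) \<ge> (1::real)" by simp
      moreover have "log 2 (log 2 3) \<ge> log 2 (3/2)" using l1 by (subst log_le_cancel_iff) auto
      moreover have "log 2 3 \<le> (2::real)" by (simp add: log_le_iff)
      ultimately have "log 2 3 - 2 * log 2 (log 2 3) \<le> (1::real)" by linarith
      then show ?thesis using 2 by (simp add: h_def)
    qed
  qed
  then have "\<lceil>log 2 n - 2 * log 2 (log 2 n)\<rceil> \<le> int h" by (simp add: ceiling_le_iff)
  then have "kap n \<le> h" using False h1 by (simp add: kap_def)
  then show ?thesis by (simp add: h_def)
qed

lemma bit_add_cancel: "a + b + b = (a :: bit)"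
  by (cases a; cases b) simp_all

lemma nth_phi:
  "i < length x \<Longrightarrow> phi x ! i = (if i < kap (length x) then x ! i + x ! (length x - kap (length x) + i) else x ! i)"
  by (simp add: phi_def Let_def)

text \<open>The letters added lie in a block that \<open>phi\<close> leaves alone, so a second
  application adds the same letters again and they cancel modulo 2.\<close>

lemma phi_phi [simp]: "phi (phi x) = x"
  using kap_le_half[of "length x"]
  by (intro nth_equalityI) (auto simp: nth_phi bit_add_cancel)

section \<open>Arcs of the twisted hypercube\<close>

abbreviation cube_arcs :: "nat \<Rightarrow> bit list rel" where
  "cube_arcs n \<equiv> parcs (twisted_hypercube n)"

abbreviation cube_verts :: "nat \<Rightarrow> bit list set" where
  "cube_verts n \<equiv> {x. length x = n}"

lemma cube_arcs_length:
  assumes "(x, y) \<in> cube_arcs n" shows "length x = n" "length y = n"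
proof -
  interpret pair_graph "twisted_hypercube n" by (rule pair_graph_twisted_hypercube)
  show "length x = n" "length y = n"
    using in_arcsD1[OF assms] in_arcsD2[OF assms] by (auto simp: pverts_twisted_hypercube)
qed

lemma sym_cube_arcs: "sym (cube_arcs n)"
proof -
  interpret pair_graph "twisted_hypercube n" by (rule pair_graph_twisted_hypercube)
  show ?thesis using sym_arcs by (simp add: symmetric_def)
qed

text \<open>One formula serves both directions of a matching edge because \<open>phi\<close> is an
  involution.\<close>

lemma cube_arcs_Cons:
  assumes "n \<ge> 1" "length x = n" "length y = n"
  shows "(b # x, c # y) \<in> cube_arcs (Suc n) \<longleftrightarrow> (if b = c then (x, y) \<in> cube_arcs n else y = phi x)"
proof -
  obtain m where m: "n = Suc m" using assms by (cases n) auto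
  show ?thesis
    using assms unfolding m twisted_hypercube.simps
    by (cases b; cases c) auto
qed

section \<open>Weighted deleted sets and their traces on the two halves\<close>

text \<open>Allowing fewer than three leaves covers all connected substars and the trace of a star
  on the half of its centre. Single vertices of weight 1 account for the trace on the other half.
  Overlaps are permitted, so \<open>w\<close> bounds a cost and is not determined by the
  set.\<close>

inductive star_cover :: "'a rel \<Rightarrow> nat \<Rightarrow> 'a set \<Rightarrow> bool" for R where
  empty: "star_cover R 0 {}"
| vertex: "star_cover R w X \<Longrightarrow> star_cover R (w + 1) (insert v X)"
| star: "star_cover R w X \<Longrightarrow> finite L \<Longrightarrow> L \<subseteq> R `` {c} \<Longrightarrow> card L \<le> 3
    \<Longrightarrow> star_cover R (w + 2) (insert c L \<union> X)"

lemma star_cover_card: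
  assumes "star_cover R w X"
  shows "finite X" "card X \<le> 2 * w" "w \<le> 1 \<Longrightarrow> card X \<le> w"
proof -
  have "finite X \<and> card X \<le> 2 * w \<and> (w \<le> 1 \<longrightarrow> card X \<le> w)"
    using assms
  proof induction
    case (vertex w X v)
    then show ?case by (auto simp: card_insert_if)
  next
    case (star w X L c)
    have "card (insert c L \<union> X) \<le> card (insert c L) + card X" by (rule card_Un_le)
    also have "\<dots> \<le> 4 + card X" using star by (simp add: card_insert_if)
    finally show ?case using star by auto
  qed simp
  then show "finite X" "card X \<le> 2 * w" "w \<le> 1 \<Longrightarrow> card X \<le> w" by auto
qed

text \<open>\<open>W b\<close> is the weight inherited by the half with first letter
  \<open>b\<close>. A star costs 2 in the half of its centre and at most 1 in the other, where its
  only possible leaf is the partner of the centre. If half \<open>b\<close> inherits everything, all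
  stars are centred there; the other half then loses only such leaves, at most one per weight 2,
  each with its partner in \<open>X\<close>.\<close>

lemma star_cover_split:
  assumes "star_cover (cube_arcs (Suc n)) w X" and "n \<ge> 1"
  obtains W :: "bit \<Rightarrow> nat" where
    "\<And>b. W b \<le> w"
    "\<And>b. star_cover (cube_arcs n) (W b) {x. b # x \<in> X}"
    "\<And>b c. W b = w \<Longrightarrow> c \<noteq> b \<Longrightarrow> 2 * W c \<le> w"
    "\<And>b c y. W b = w \<Longrightarrow> c \<noteq> b \<Longrightarrow> c # y \<in> X \<Longrightarrow> b # phi y \<in> X"
proof -
  have "\<exists>W :: bit \<Rightarrow> nat. \<forall>b. W b \<le> w \<and> star_cover (cube_arcs n) (W b) {x. b # x \<in> X} \<and>
    (W b = w \<longrightarrow> (\<forall>c. c \<noteq> b \<longrightarrow> 2 * W c \<le> w \<and> (\<forall>y. c # y \<in> X \<longrightarrow> b # phi y \<in> X)))"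
    (is "\<exists>W. ?P w X W")
    using assms(1)
  proof induction
    case empty
    show ?case by (rule exI[of _ "\<lambda>_. 0"]) (auto intro: star_cover.empty)
  next
    case (vertex w X v)
    then obtain W where "?P w X W" by blast
    then have W: "\<And>b. W b \<le> w" "\<And>b. star_cover (cube_arcs n) (W b) {x. b # x \<in> X}"
      "\<And>b c. W b = w \<Longrightarrow> c \<noteq> b \<Longrightarrow> 2 * W c \<le> w"
      "\<And>b c y. W b = w \<Longrightarrow> c \<noteq> b \<Longrightarrow> c # y \<in> X \<Longrightarrow> b # phi y \<in> X" by blast+
    have ne: "W b \<noteq> Suc w" for b using W(1)[of b] by simp
    show ?case
    proof (cases v)
      \<comment> \<open>The deleted vertex is an arbitrary word. The empty word lies in neither
        half, and since \<open>W\<close> stays below \<open>w + 1\<close>, the conditional clauses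
        become vacuous.\<close>
      case Nil
      then have "?P (w + 1) (insert v X) W" using W ne by (auto intro: le_SucI)
      then show ?thesis by blast
    next
      case (Cons a u)
      let ?W = "\<lambda>b. if b = a then W a + 1 else W b"
      have "?P (w + 1) (insert v X) ?W"
      proof (intro allI conjI impI)
        fix b
        show "?W b \<le> w + 1" using W(1) by (simp add: le_SucI)
        have "{x. b # x \<in> insert v X} = (if b = a then insert u {x. a # x \<in> X} else {x. b # x \<in> X})"
          using Cons by auto
        then show "star_cover (cube_arcs n) (?W b) {x. b # x \<in> insert v X}"
          using W(2) star_cover.vertex[OF W(2)[of a]] by simp
        fix c assume "?W b = w + 1" and c: "c \<noteq> b"
        then have b: "b = a" "W b = w" using ne[of b] by (auto split: if_splits)
        then show "2 * ?W c \<le> w + 1" using W(3)[of b c] c by simp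
        fix y assume "c # y \<in> insert v X"
        then show "b # phi y \<in> insert v X" using b c W(4)[of b c y] Cons by simp
      qed
      then show ?thesis by (rule exI[where P = "?P (w + 1) (insert v X)"])
    qed
  next
    case (star w X L c)
    then obtain W where "?P w X W" by blast
    then have W: "\<And>b. W b \<le> w" "\<And>b. star_cover (cube_arcs n) (W b) {x. b # x \<in> X}"
      "\<And>b c. W b = w \<Longrightarrow> c \<noteq> b \<Longrightarrow> 2 * W c \<le> w"
      "\<And>b c y. W b = w \<Longrightarrow> c \<noteq> b \<Longrightarrow> c # y \<in> X \<Longrightarrow> b # phi y \<in> X" by blast+
    have ne: "W b \<noteq> Suc w" "W b \<noteq> Suc (Suc w)" for b using W(1)[of b] by simp_all
    let ?X = "insert c L \<union> X"
    show ?case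
    proof (cases c)
      case Nil
      then have "L = {}" using star(3) cube_arcs_length by fastforce
      then have "?P (w + 2) ?X W" using Nil W ne by (auto intro: le_SucI)
      then show ?thesis by blast
    next
      case (Cons a u)
      \<comment> \<open>Away from the half of the centre the increase is at most 1, so only
        \<open>b = a\<close> can reach the full weight \<open>w + 2\<close>.\<close>
      let ?W = "\<lambda>b. if b = a then W a + 2 else W b + (if b # phi u \<in> L then 1 else 0)"
      have leaf: "b = a \<Longrightarrow> (u, y) \<in> cube_arcs n" "b \<noteq> a \<Longrightarrow> y = phi u" if "b # y \<in> L" for b y
      proof -
        have e: "(a # u, b # y) \<in> cube_arcs (Suc n)" using that star(3) Cons by auto
        then have "length u = n" "length y = n" using cube_arcs_length by fastforce+
        with e show "b = a \<Longrightarrow> (u, y) \<in> cube_arcs n" "b \<noteq> a \<Longrightarrow> y = phi u"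
          using assms(2) by (auto simp: cube_arcs_Cons)
      qed
      have A: "star_cover (cube_arcs n) (W a + 2) (insert u {y. a # y \<in> L} \<union> {x. a # x \<in> X})"
      proof (rule star_cover.star[OF W(2)])
        show "finite {y. a # y \<in> L}"
          using finite_vimageI[OF star(2), of "Cons a"] by (simp add: vimage_def)
        have "card {y. a # y \<in> L} = card (Cons a ` {y. a # y \<in> L})"
          by (simp add: card_image)
        also have "\<dots> \<le> card L" by (rule card_mono) (use star in auto)
        finally show "card {y. a # y \<in> L} \<le> 3" using star by simp
      qed (use leaf in auto)
      have "?P (w + 2) ?X ?W"
      proof (intro allI conjI impI)
        fix b
        show "?W b \<le> w + 2" using W(1)[of b] by auto
        show "star_cover (cube_arcs n) (?W b) {x. b # x \<in> ?X}"
        proof (cases "b = a")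
          case True
          have "{x. a # x \<in> ?X} = insert u {y. a # y \<in> L} \<union> {x. a # x \<in> X}"
            using Cons by auto
          then show ?thesis using A True by simp
        next
          case False
          have "{x. b # x \<in> L} = (if b # phi u \<in> L then {phi u} else {})"
            by (rule set_eqI) (use leaf(2)[OF _ False] in \<open>metis empty_iff mem_Collect_eq singleton_iff\<close>)
          moreover have "{x. b # x \<in> ?X} = {x. b # x \<in> L} \<union> {x. b # x \<in> X}"
            using Cons False by auto
          ultimately have "{x. b # x \<in> ?X} = (if b # phi u \<in> L then {phi u} else {}) \<union> {x. b # x \<in> X}"
            by simp
          then show ?thesis
            using False W(2)[of b] star_cover.vertex[OF W(2)[of b]] by simp
        qed
        fix d assume "?W b = w + 2" and d: "d \<noteq> b"
        then have b: "b = a" "W b = w"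
          using ne[of b] by (auto split: if_splits)
        then show "2 * ?W d \<le> w + 2" using W(3)[of b d] d by simp
        fix y assume "d # y \<in> ?X"
        then show "b # phi y \<in> ?X"
          using b d W(4)[of b d y] Cons leaf(2)[of d y] by auto
      qed
      then show ?thesis by (rule exI[where P = "?P (w + 2) ?X"])
    qed
  qed
  then show ?thesis using that by blast
qed

section \<open>Connectivity after deleting a set of small weight\<close>

lemma finite_cube_verts: "finite (cube_verts n)"
  and card_cube_verts: "card (cube_verts n) = 2 ^ n"
proof -
  have U: "(UNIV :: bit set) = {0, 1}"
    using bit_not_zero_iff by blast
  have fin: "finite (UNIV :: bit set)" by (subst U) simp
  have "card (UNIV :: bit set) = 2" by (subst U) simp
  then show "finite (cube_verts n)" "card (cube_verts n) = 2 ^ n"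
    using finite_lists_length_eq[OF fin, of n] card_lists_length_eq[OF fin, of n] by simp_all
qed

lemma rtrancl_on_sym:
  assumes "sym R" "(a, b) \<in> rtrancl_on F R" shows "(b, a) \<in> rtrancl_on F R"
  using rtrancl_on_converseI[OF assms(2)] assms(1) by (simp add: sym_conv_converse_eq)

text \<open>Counting: there are \<open>2 ^ n\<close> disjoint matching edges, and hitting them all
  takes as many deleted vertices, whereas \<open>X\<close> has at most \<open>2 * w\<close>
  elements.\<close>

lemma small_cover_misses_matching_edge:
  assumes "star_cover (cube_arcs (Suc n)) w X" "w \<le> n"
    and "star_cover (cube_arcs n) w0 {x. 0 # x \<in> X}" "star_cover (cube_arcs n) w1 {x. 1 # x \<in> X}"
    and "w0 < n" "w1 < n"
  shows "\<exists>x. length x = n \<and> 0 # x \<notin> X \<and> 1 # phi x \<notin> X"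
proof (rule ccontr)
  let ?Y = "\<lambda>b. {x. b # x \<in> X}"
  assume "\<not> ?thesis"
  then have "cube_verts n \<subseteq> ?Y 0 \<union> phi ` ?Y 1"
    by (force simp: image_iff intro: exI[of _ "phi _"])
  moreover have fin: "finite (?Y 0)" "finite (?Y 1)" "finite X"
    using assms star_cover_card(1) by blast+
  ultimately have "2 ^ n \<le> card (?Y 0 \<union> phi ` ?Y 1)"
    by (metis (no_types, lifting) card_cube_verts card_mono finite_UnI finite_imageI)
  also have "\<dots> \<le> card (?Y 0) + card (phi ` ?Y 1)" by (rule card_Un_le)
  also have "\<dots> \<le> card (?Y 0) + card (?Y 1)" using fin by (simp add: card_image_le)
  finally have many: "2 ^ n \<le> card (?Y 0) + card (?Y 1)" .
  show False
  \<comment> \<open>The inequality \<open>2 * n < 2 ^ n\<close> starts at 3. Below that each half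
    has weight at most 1, hence no more deleted vertices than its weight.\<close>
  proof (cases "n \<le> 2")
    case True
    then have "card (?Y 0) \<le> w0" "card (?Y 1) \<le> w1"
      using star_cover_card(3)[OF assms(3)] star_cover_card(3)[OF assms(4)] assms(5,6) by auto
    moreover have "n = 1 \<or> n = 2" using assms True by linarith
    ultimately show False using many assms(5,6) by auto
  next
    case False
    have "card (?Y 0) + card (?Y 1) = card (Cons 0 ` ?Y 0) + card (Cons 1 ` ?Y 1)"
      by (simp add: card_image)
    also have "\<dots> = card (Cons 0 ` ?Y 0 \<union> Cons 1 ` ?Y 1)"
      using fin by (intro card_Un_disjoint[symmetric]) auto
    also have "\<dots> \<le> card X" using fin by (intro card_mono) auto
    also have "\<dots> \<le> 2 * n" using star_cover_card(2)[OF assms(1)] assms(2) by linarith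
    also have "\<dots> < 2 ^ n"
    proof -
      have "n \<ge> 3" using False by simp
      then show ?thesis by (induction n rule: nat_induct_at_least) auto
    qed
    finally show False using many by simp
  qed
qed

lemma cube_minus_cover_reachable:
  assumes "n \<ge> 1" "star_cover (cube_arcs n) w X" "w < n"
    "u \<in> cube_verts n - X" "v \<in> cube_verts n - X"
  shows "(u, v) \<in> rtrancl_on (cube_verts n - X) (cube_arcs n)"
  using assms
proof (induction n arbitrary: w X u v rule: nat_induct_at_least)
  case base
  then have "star_cover (cube_arcs 1) 0 X" by simp
  then have "X = {}" by (rule star_cover.cases) auto
  moreover have "u \<in> {[0], [1]}" "v \<in> {[0], [1]}"
    using base by (auto simp: length_Suc_conv)
  then have "u = v \<or> (u, v) \<in> cube_arcs 1" by auto
  ultimately show ?case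
    using base rtrancl_on_into_rtrancl_on[OF rtrancl_on_refl, of u "cube_verts 1" v "cube_arcs 1"]
    by auto
next
  case (Suc n)
  let ?V = "cube_verts (Suc n) - X" and ?R = "cube_arcs (Suc n)"
  obtain W where W: "\<And>b. W b \<le> w" "\<And>b. star_cover (cube_arcs n) (W b) {x. b # x \<in> X}"
      "\<And>b c. W b = w \<Longrightarrow> c \<noteq> b \<Longrightarrow> 2 * W c \<le> w"
      "\<And>b c y. W b = w \<Longrightarrow> c \<noteq> b \<Longrightarrow> c # y \<in> X \<Longrightarrow> b # phi y \<in> X"
    by (rule star_cover_split[OF Suc.prems(1) Suc.hyps], rule that)
  have lift: "(b # x, b # y) \<in> rtrancl_on ?V ?R"
    if "W b < n" "b # x \<in> ?V" "b # y \<in> ?V" for b x y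
  proof -
    have "(x, y) \<in> rtrancl_on (cube_verts n - {x. b # x \<in> X}) (cube_arcs n)"
      using Suc.IH[OF W(2) that(1)] that by auto
    then show ?thesis
    proof (induction rule: rtrancl_on_induct)
      case base
      show ?case using that(2) by (rule rtrancl_on_refl)
    next
      case (step y z)
      then have "(b # y, b # z) \<in> ?R" "b # z \<in> ?V"
        using Suc.hyps by (auto simp: cube_arcs_Cons)
      then show ?case using step.IH rtrancl_on_into_rtrancl_on by metis
    qed
  qed
  have cross: "(b # x, c # phi x) \<in> rtrancl_on ?V ?R"
    if "b \<noteq> c" "b # x \<in> ?V" "c # phi x \<in> ?V" for b c x
  proof -
    have "(b # x, c # phi x) \<in> ?R"
      using that Suc.hyps by (auto simp: cube_arcs_Cons)
    then show ?thesis
      by (rule rtrancl_on_into_rtrancl_on[OF rtrancl_on_refl[OF that(2)] _ that(3)])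
  qed
  \<comment> \<open>It suffices to find one half that is connected by the induction hypothesis and
    is reached from every remaining vertex; \<open>u\<close> and \<open>v\<close> are then joined
    through it.\<close>
  have "\<exists>b. W b < n \<and> (\<forall>x \<in> ?V. \<exists>y. (x, b # y) \<in> rtrancl_on ?V ?R)"
  proof (cases "\<forall>b. W b < n")
    case True
    then obtain x where x: "length x = n" "0 # x \<notin> X" "1 # phi x \<notin> X"
      using small_cover_misses_matching_edge[OF Suc.prems(1) _ W(2) W(2)] Suc.prems by auto
    have "\<exists>y. (u, 0 # y) \<in> rtrancl_on ?V ?R" if u: "u \<in> ?V" for u
    proof -
      obtain b u' where u': "u = b # u'" using u by (cases u) auto
      show ?thesis
      proof (cases "b = 0")
        case True
        then show ?thesis using rtrancl_on_refl[OF u] u' by metis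
      next
        case False
        then have b: "u = 1 # u'" using u' by simp
        have "(u, 1 # phi x) \<in> rtrancl_on ?V ?R"
          using lift[of 1 u' "phi x"] True u x b by auto
        moreover have "(1 # phi x, 0 # phi (phi x)) \<in> rtrancl_on ?V ?R"
          using x by (intro cross) auto
        ultimately show ?thesis using rtrancl_on_trans by metis
      qed
    qed
    then show ?thesis using True by blast
  next
    case False
    then obtain b where "\<not> W b < n" by blast
    \<comment> \<open>From \<open>n \<le> W b \<le> w < Suc n\<close> it follows that half
      \<open>b\<close> carries the whole weight.\<close>
    then have b: "W b = w" "w = n" using W(1)[of b] Suc.prems by auto
    obtain c where c: "c \<noteq> b" by (metis zero_neq_one)
    have "\<exists>y. (u, c # y) \<in> rtrancl_on ?V ?R" if u: "u \<in> ?V" for u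
    proof -
      obtain a u' where u': "u = a # u'" using u by (cases u) auto
      show ?thesis
      proof (cases "a = c")
        case True
        then show ?thesis using rtrancl_on_refl[OF u] u' by metis
      next
        case False
        then have "a = b" using c by (metis bit_not_one_iff)
        \<comment> \<open>Were this vertex deleted, its partner \<open>b # phi (phi u')\<close>,
          which is \<open>u\<close>, would be deleted too.\<close>
        moreover have "c # phi u' \<notin> X"
          using W(4)[OF b(1) c, of "phi u'"] u u' \<open>a = b\<close> by auto
        ultimately have "(b # u', c # phi u') \<in> rtrancl_on ?V ?R"
          using c u u' by (intro cross) auto
        then show ?thesis using u' \<open>a = b\<close> by metis
      qed
    qed
    moreover have "W c < n" using W(3)[OF b(1) c] b Suc.hyps by simp
    ultimately show ?thesis by blast
  qed
  then obtain b y z where b: "W b < n"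
    and yz: "(u, b # y) \<in> rtrancl_on ?V ?R" "(v, b # z) \<in> rtrancl_on ?V ?R"
    using Suc.prems by blast
  have "(b # y, b # z) \<in> rtrancl_on ?V ?R"
    using yz[THEN in_rtrancl_on_in_F(2)] by (intro lift b)
  then show ?case
    using yz(1) rtrancl_on_sym[OF sym_cube_arcs yz(2)] rtrancl_on_trans by metis
qed

section \<open>The lower bound for substructure cuts\<close>

lemma rtrancl_on_last_step:
  assumes "(a, b) \<in> rtrancl_on F r" "a \<noteq> b"
  shows "\<exists>y \<in> F. (y, b) \<in> r"
  using assms by (cases rule: rtrancl_on.cases) (auto dest: in_rtrancl_on_in_F)

text \<open>In a connected graph with two or more vertices each vertex has a neighbour. If 0 is
  present, it must be the neighbour of all others; if it is absent, no arcs remain and there is a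
  single vertex, a star with \<open>L = {}\<close>.\<close>

lemma connected_substar_shape:
  assumes S: "ugraph_subgraph S (star 3)" and "connected S"
  obtains c L where "pverts S = insert c L" "{c} \<times> L \<subseteq> parcs S" "finite L" "card L \<le> 3"
proof -
  interpret pair_graph S using S by (simp add: ugraph_subgraph_def)
  have V: "pverts S \<subseteq> {0..3}" and E: "parcs S \<subseteq> {0} \<times> {1..3} \<union> {1..3} \<times> {0}"
    using S by (auto simp: ugraph_subgraph_def subgraph_def star_def)
  have ne: "pverts S \<noteq> {}"
    and R: "\<And>u v. u \<in> pverts S \<Longrightarrow> v \<in> pverts S \<Longrightarrow>
      (u, v) \<in> rtrancl_on (pverts S) ((parcs S)\<^sup>s)"
    using \<open>connected S\<close> by (auto simp: connected_conv)
  have sym: "(x, y) \<in> parcs S \<longleftrightarrow> (y, x) \<in> parcs S" for x y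
    using sym_arcs by (auto simp: symmetric_def dest: symD)
  have nb: "\<exists>y. (y, v) \<in> parcs S" if "u \<in> pverts S" "v \<in> pverts S" "u \<noteq> v" for u v
    using rtrancl_on_last_step[OF R[OF that(1,2)] that(3)] sym by (auto simp: symcl_def)
  show ?thesis
  proof (cases "0 \<in> pverts S")
    case True
    have "(0, v) \<in> parcs S" if "v \<in> pverts S" "v \<noteq> 0" for v
      using nb[OF True that(1)] E that(2) by force
    moreover have "pverts S - {0} \<subseteq> {1..3}" using V by force
    then have "finite (pverts S - {0})" "card (pverts S - {0}) \<le> 3"
      using card_mono[of "{1..3::nat}" "pverts S - {0}"] by (auto intro: finite_subset)
    ultimately show ?thesis using that[of 0 "pverts S - {0}"] True by auto
  next
    case False
    have "u = v" if uv: "u \<in> pverts S" "v \<in> pverts S" for u v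
    proof (rule ccontr)
      assume "u \<noteq> v"
      then obtain y where y: "(y, v) \<in> parcs S" using nb uv by blast
      then have "y = 0 \<or> v = 0" using E by auto
      then show False using False uv in_arcsD1[OF y] by auto
    qed
    then obtain c where "pverts S = {c}" using ne by blast
    then show ?thesis using that[of c "{}"] by simp
  qed
qed

text \<open>The map \<open>f\<close> inverts the vertex part of the isomorphism, so that the centre
  and leaves found in \<open>S\<close> can be carried back to \<open>H\<close>.\<close>

lemma digraph_iso_pair_pull:
  assumes "digraph_iso (with_proj H) (with_proj S)" "pair_graph H"
  obtains f where "pverts H = f ` pverts S" "\<And>x y. (x, y) \<in> parcs S \<Longrightarrow> (f x, f y) \<in> parcs H"
proof -
  interpret pair_graph H by fact
  obtain h where h: "pre_digraph.digraph_isomorphism (with_proj H) h" "with_proj S = app_iso h (with_proj H)"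
    using assms(1) by (auto simp: digraph_iso_def)
  define f where "f = the_inv_into (pverts H) (iso_verts h)"
  have inj: "inj_on (iso_verts h) (pverts H)"
    using h(1) by (simp add: pre_digraph.digraph_isomorphism_def)
  have f: "f (iso_verts h x) = x" if "x \<in> pverts H" for x
    using the_inv_into_f_f[OF inj that] by (simp add: f_def)
  \<comment> \<open>An isomorphism maps arcs separately from vertices. That the new tail and head
    maps are the projections ties the image of an arc to the images of its ends.\<close>
  have S: "pverts S = iso_verts h ` pverts H" "parcs S = iso_arcs h ` parcs H"
    "iso_tail h = fst" "iso_head h = snd"
    using arg_cong[OF h(2), of verts] arg_cong[OF h(2), of arcs]
      arg_cong[OF h(2), of tail] arg_cong[OF h(2), of head] by simp_all
  show ?thesis
  proof
    show "pverts H = f ` pverts S" using f by (force simp: S image_image)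
    fix x y assume "(x, y) \<in> parcs S"
    then obtain p q where pq: "(p, q) \<in> parcs H" "iso_arcs h (p, q) = (x, y)"
      unfolding S by (metis (no_types, lifting) imageE surj_pair)
    then have "iso_verts h p = x" "iso_verts h q = y"
      using h(1) by (auto simp: pre_digraph.digraph_isomorphism_def S(3,4) dest!: bspec[OF _ pq(1)])
    then show "(f x, f y) \<in> parcs H"
      using f in_arcsD1[OF pq(1)] in_arcsD2[OF pq(1)] pq(1) by auto
  qed
qed

text \<open>Every member is the image of a star with at most three leaves and so costs weight
  2.\<close>

lemma star_cover_family:
  assumes "finite F"
    and "\<And>H. H \<in> F \<Longrightarrow> ugraph_subgraph H G \<and>
      (\<exists>S. ugraph_subgraph S (star 3) \<and> connected S \<and> digraph_iso H S)"
  shows "star_cover (parcs G) (2 * card F) (\<Union>H\<in>F. pverts H)"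
  using assms
proof (induction F)
  case empty
  show ?case by (simp add: star_cover.empty)
next
  case (insert H F)
  obtain S where S: "ugraph_subgraph S (star 3)" "connected S" "digraph_iso H S"
    using insert.prems by blast
  have H: "pair_graph H" "parcs H \<subseteq> parcs G"
    using insert.prems[of H] by (auto simp: ugraph_subgraph_def subgraph_def)
  obtain c L where L: "pverts S = insert c L" "{c} \<times> L \<subseteq> parcs S" "finite L" "card L \<le> 3"
    using connected_substar_shape[OF S(1,2)] by blast
  obtain f where f: "pverts H = f ` pverts S" "\<And>x y. (x, y) \<in> parcs S \<Longrightarrow> (f x, f y) \<in> parcs H"
    using digraph_iso_pair_pull[OF S(3) H(1)] by blast
  have "star_cover (parcs G) (2 * card F + 2) (insert (f c) (f ` L) \<union> (\<Union>H\<in>F. pverts H))"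
  proof (rule star_cover.star)
    show "f ` L \<subseteq> parcs G `` {f c}" using f(2) L(2) H(2) by auto
    show "card (f ` L) \<le> 3" using card_image_le[OF L(3), of f] L(4) by linarith
  qed (use insert L in auto)
  then show ?case using insert.hyps f(1) L(1) by simp
qed

lemma connected_delete_family:
  assumes "n \<ge> 1" "star_cover (cube_arcs n) w (\<Union>H\<in>F. pverts H)" "w < n"
  shows "\<not> disconnected_graph (delete_family (twisted_hypercube n) F)"
proof -
  let ?G = "delete_family (twisted_hypercube n) F"
  let ?V = "cube_verts n - (\<Union>H\<in>F. pverts H)"
  have V: "verts ?G = ?V" by (simp add: delete_family_def pverts_twisted_hypercube)
  have A: "arcs_ends ?G = {e \<in> cube_arcs n. fst e \<in> ?V \<and> snd e \<in> ?V}"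
    by (auto simp: delete_family_def pverts_twisted_hypercube arcs_ends_conv image_iff)
  have "(u, v) \<in> rtrancl_on ?V ((arcs_ends ?G)\<^sup>s)" if "u \<in> ?V" "v \<in> ?V" for u v
    using cube_minus_cover_reachable[OF assms that]
  proof (induction rule: rtrancl_on_induct)
    case (step y z)
    then have "(y, z) \<in> (arcs_ends ?G)\<^sup>s" unfolding symcl_def A by auto
    then show ?case using step rtrancl_on_into_rtrancl_on by metis
  qed (rule rtrancl_on_refl)
  then show ?thesis unfolding disconnected_graph_def connected_conv V by blast
qed

lemma substructure_cut_star_card:
  assumes "n \<ge> 1" "substructure_cut (twisted_hypercube n) (star 3) F"
  shows "n \<le> 2 * card F"
proof (rule ccontr)
  assume "\<not> ?thesis"
  moreover have "star_cover (cube_arcs n) (2 * card F) (\<Union>H\<in>F. pverts H)"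
    using assms(2) by (intro star_cover_family) (auto simp: substructure_cut_def)
  ultimately show False
    using connected_delete_family[OF assms(1)] assms(2) by (auto simp: substructure_cut_def)
qed

section \<open>Neighbours of the zero word and vertex degrees\<close>

lemma phi_zero: "phi (replicate m 0) = replicate m 0"
  by (intro nth_equalityI) (auto simp: nth_phi)

text \<open>The letters added come from positions at or after \<open>Suc m - kap (Suc m)\<close>,
  which is positive by \<open>kap_le_half\<close>, so all of them are 0.\<close>

lemma phi_unit: "phi (1 # replicate m 0) = 1 # replicate m 0"
  using kap_le_half[of "Suc m"]
  by (intro nth_equalityI) (auto simp: nth_phi nth_Cons')

lemma cube_arcs_zero_prefix:
  assumes "m \<ge> 1" "(x, y) \<in> cube_arcs m"
  shows "(replicate k 0 @ x, replicate k 0 @ y) \<in> cube_arcs (k + m)"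
  by (induction k) (use assms cube_arcs_length[OF assms(2)] in \<open>auto simp: cube_arcs_Cons\<close>)

text \<open>The index counts trailing zeros, so that it does not change when a zero is
  prefixed.\<close>

definition unit_vertex :: "nat \<Rightarrow> nat \<Rightarrow> bit list" where
  "unit_vertex n m = replicate (n - Suc m) 0 @ 1 # replicate m 0"

text \<open>At each level \<open>phi\<close> fixes the zero word, so the matching edge there leads
  to a 1 followed by zeros; the other neighbours come from the level below.\<close>

lemma zero_neighbours:
  assumes "(replicate n 0, y) \<in> cube_arcs n"
  shows "\<exists>m < n. y = unit_vertex n m"
  using assms
proof (induction n arbitrary: y)
  case 0
  then show ?case by simp
next
  case (Suc n)
  show ?case
  proof (cases "n = 0")
    case True
    then show ?thesis using Suc.prems by (auto simp: unit_vertex_def)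
  next
    case False
    obtain b z where y: "y = b # z" "length z = n"
      using cube_arcs_length(2)[OF Suc.prems] by (auto simp: length_Suc_conv)
    show ?thesis
    proof (cases "b = 0")
      case True
      then have "(replicate n 0, z) \<in> cube_arcs n"
        using Suc.prems y False by (simp add: cube_arcs_Cons)
      from Suc.IH[OF this] obtain m where "m < n" "z = unit_vertex n m" by blast
      then have "m < Suc n" "y = unit_vertex (Suc n) m"
        using True y by (auto simp: unit_vertex_def Suc_diff_Suc simp flip: replicate_Suc append_Cons)
      then show ?thesis by blast
    next
      case b: False
      then have "z = phi (replicate n 0)"
        using Suc.prems y False cube_arcs_Cons[of n "replicate n 0" z 0 b] by simp
      then have "y = unit_vertex (Suc n) n" using b y by (simp add: unit_vertex_def phi_zero)
      then show ?thesis by blast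
    qed
  qed
qed

text \<open>Regularity guarantees enough leaves: for \<open>n \<ge> 4\<close> a vertex keeps three
  neighbours even when one is forbidden. Each level adds exactly one neighbour, the partner in the
  other half.\<close>

lemma card_cube_neighbours:
  assumes "n \<ge> 1" "length x = n"
  shows "card (cube_arcs n `` {x}) = n"
  using assms
proof (induction n arbitrary: x rule: nat_induct_at_least)
  case base
  then have "x = [0] \<or> x = [1]" by (auto simp: length_Suc_conv)
  then have "cube_arcs 1 `` {x} = {[1]} \<or> cube_arcs 1 `` {x} = {[0]}" by auto
  then show ?case by (metis One_nat_def card_1_singleton_iff)
next
  case (Suc n)
  obtain b y where x: "x = b # y" "length y = n" using Suc.prems by (cases x) auto
  obtain c where c: "c \<noteq> b" by (metis zero_neq_one)
  have bc: "d = b \<or> d = c" for d using c by (metis bit_not_one_iff)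
  have "cube_arcs (Suc n) `` {x} = insert (c # phi y) (Cons b ` (cube_arcs n `` {y}))"
  proof (rule set_eqI)
    fix z
    show "z \<in> cube_arcs (Suc n) `` {x} \<longleftrightarrow> z \<in> insert (c # phi y) (Cons b ` (cube_arcs n `` {y}))"
    proof (cases "length z = Suc n")
      case True
      then obtain d w where z: "z = d # w" "length w = n" by (cases z) auto
      then show ?thesis
        using bc[of d] c x Suc.hyps by (auto simp: cube_arcs_Cons)
    next
      case False
      then show ?thesis using x cube_arcs_length(2) by fastforce
    qed
  qed
  moreover have "finite (cube_arcs n `` {y})"
    by (rule finite_subset[OF _ finite_cube_verts[of n]]) (use cube_arcs_length(2) in auto)
  ultimately show ?case using Suc.IH[OF x(2)] c
    by (auto simp: card_insert_if card_image)
qed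

section \<open>Concrete stars as subgraphs\<close>

definition star_at :: "'a \<Rightarrow> 'a set \<Rightarrow> 'a pair_pre_digraph" where
  "star_at c L = \<lparr> pverts = insert c L, parcs = {c} \<times> L \<union> L \<times> {c} \<rparr>"

lemma pair_graph_star_at: "finite L \<Longrightarrow> c \<notin> L \<Longrightarrow> pair_graph (star_at c L)"
  by unfold_locales (auto simp: star_at_def symmetric_def intro!: symI)

lemma star_at_subgraph:
  assumes "pair_graph G" "c \<in> pverts G" "L \<subseteq> parcs G `` {c}"
  shows "c \<notin> L" "ugraph_subgraph (star_at c L) G"
proof -
  interpret pair_graph G by fact
  show c: "c \<notin> L" using assms(3) pair_no_loops by fastforce
  have L: "L \<subseteq> pverts G" using assms(3) in_arcsD2 by blast
  then have "finite L" using pair_finite_verts finite_subset by blast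
  then interpret S: pair_graph "star_at c L" using c by (rule pair_graph_star_at)
  have "(y, x) \<in> parcs G" if "(x, y) \<in> parcs G" for x y
    using sym_arcs that by (auto simp: symmetric_def dest: symD)
  then have "parcs (star_at c L) \<subseteq> parcs G" using assms(3) by (auto simp: star_at_def)
  moreover have "pverts (star_at c L) \<subseteq> pverts G" using assms(2) L by (simp add: star_at_def)
  ultimately show "ugraph_subgraph (star_at c L) G"
    unfolding ugraph_subgraph_def subgraph_def compatible_def
    using S.pair_graph_axioms wf_digraph S.wf_digraph by auto
qed

lemma star_at_iso_star:
  assumes "c \<notin> L" "finite L"
  shows "digraph_iso (star_at c L) (star (card L))"
proof -
  interpret pair_graph "star_at c L" using assms by (intro pair_graph_star_at)
  obtain h where h: "bij_betw h L {1..card L}"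
    using finite_same_card_bij[OF assms(2), of "{1..card L}"] by auto
  \<comment> \<open>The centre goes to 0 and the leaves to \<open>{1..card L}\<close>; as
    \<open>c\<close> is not a leaf, the update leaves \<open>h\<close> intact on
    \<open>L\<close>.\<close>
  define g where "g = h(c := 0)"
  have "bij_betw g L {1..card L} \<longleftrightarrow> bij_betw h L {1..card L}"
    using assms(1) by (intro bij_betw_cong) (auto simp: g_def)
  with h have g: "bij_betw g L {1..card L}" "g c = 0" by (simp_all add: g_def)
  then have im: "g ` L = {1..card L}" and inj: "inj_on g (insert c L)"
    using assms(1) by (auto simp: bij_betw_def inj_on_insert)
  define f :: "('a, 'a \<times> 'a, nat, nat \<times> nat) digraph_isomorphism" where
    "f = \<lparr> iso_verts = g, iso_arcs = map_prod g g, iso_head = snd, iso_tail = fst \<rparr>"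
  have "inj_on (map_prod g g) (insert c L \<times> insert c L)"
    using inj by (rule map_prod_inj_on[OF _ inj])
  then have "inj_on (map_prod g g) (parcs (star_at c L))"
    by (rule inj_on_subset) (auto simp: star_at_def)
  then have "pre_digraph.digraph_isomorphism (with_proj (star_at c L)) f"
    using inj wf_digraph unfolding pre_digraph.digraph_isomorphism_def
    by (simp add: f_def star_at_def)
  moreover have "g ` insert c L = {0..card L}" using im g(2) by (auto simp: image_insert)
  moreover have "map_prod g g ` ({c} \<times> L \<union> L \<times> {c}) = {0} \<times> {1..card L} \<union> {1..card L} \<times> {0}"
    using g(2) by (simp only: image_Un map_prod_surj_on[OF _ im, of g "{c}" "{0}"]
      map_prod_surj_on[OF im, of g "{c}" "{0}"] image_insert image_empty)
  ultimately show ?thesis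
    unfolding digraph_iso_def
    by (intro exI[of _ f]) (simp add: app_iso_def f_def star_at_def star_def with_proj_def)
qed

lemma connected_star: "connected (with_proj (star r))"
proof -
  have "(0, v) \<in> rtrancl_on {0..r} ((parcs (star r))\<^sup>s)" if "v \<in> {0..r}" for v
  proof (cases "v = 0")
    case False
    then show ?thesis using that
      by (intro rtrancl_on_into_rtrancl_on[OF rtrancl_on_refl]) (auto simp: symcl_def star_def)
  qed simp
  moreover have "sym ((parcs (star r))\<^sup>s)" by (auto simp: sym_def symcl_def)
  ultimately have "(u, v) \<in> rtrancl_on {0..r} ((parcs (star r))\<^sup>s)" if "u \<in> {0..r}" "v \<in> {0..r}" for u v
    using that rtrancl_on_sym rtrancl_on_trans by metis
  then show ?thesis by (simp add: connected_conv star_def)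
qed

lemma ugraph_subgraph_star_refl: "ugraph_subgraph (star r) (star r)"
proof -
  have "star r = star_at 0 {1..r}" by (auto simp: star_at_def star_def)
  then interpret pair_graph "star r" using pair_graph_star_at[of "{1..r}" 0] by simp
  show ?thesis using pair_graph_axioms wf_digraph
    by (simp add: ugraph_subgraph_def subgraph_def compatible_def)
qed

lemma structure_cut_imp_substructure_cut:
  "structure_cut G (star r) F \<Longrightarrow> substructure_cut G (star r) F"
  using ugraph_subgraph_star_refl connected_star
  unfolding structure_cut_def substructure_cut_def by blast

section \<open>A structure cut isolating the zero word\<close>

text \<open>Since \<open>c\<close> has degree at least 4, the prescribed leaves \<open>R\<close>
  extend to exactly three leaves avoiding \<open>v\<close>. The vertex count serves to show later
  that the cut leaves another vertex besides the zero word.\<close>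

lemma cube_star_through:
  assumes "n \<ge> 4" "length c = n" "c \<noteq> v" "R \<subseteq> cube_arcs n `` {c} - {v}" "card R \<le> 3"
  shows "\<exists>H. ugraph_subgraph H (twisted_hypercube n) \<and> digraph_iso H (star 3) \<and>
    insert c R \<subseteq> pverts H \<and> v \<notin> pverts H \<and> card (pverts H) = 4"
proof -
  let ?N = "cube_arcs n `` {c} - {v}"
  have fin: "finite ?N"
    by (rule finite_subset[OF _ finite_cube_verts[of n]]) (use cube_arcs_length(2) in auto)
  have "card (cube_arcs n `` {c}) - card {v} \<le> card ?N"
    by (rule diff_card_le_card_Diff) simp
  then have "3 \<le> card ?N" using card_cube_neighbours[of n c] assms by simp
  then obtain L where L: "R \<subseteq> L" "L \<subseteq> ?N" "card L = 3"
    using exists_subset_between[OF assms(5) _ assms(4) fin] by blast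
  have fL: "finite L" using L(2) fin finite_subset by blast
  have c: "c \<notin> L" "ugraph_subgraph (star_at c L) (twisted_hypercube n)"
    using star_at_subgraph[OF pair_graph_twisted_hypercube, of c n L] L(2) assms(2)
    by (auto simp: pverts_twisted_hypercube)
  show ?thesis
    using c L fL star_at_iso_star[OF c(1) fL] assms(3)
    by (intro exI[of _ "star_at c L"]) (auto simp: star_at_def)
qed

text \<open>Here \<open>c\<close> is the sum of two consecutive unit words. In dimension
  \<open>k + 2\<close> its matching edge changes only the first letter by \<open>phi_unit\<close>,
  and one level below the matching edge changes only the second by \<open>phi_zero\<close>; prefixed
  zeros preserve both edges.\<close>

lemma unit_pair_neighbours:
  assumes "Suc k < n"
  defines "c \<equiv> replicate (n - Suc (Suc k)) 0 @ 1 # 1 # replicate k (0 :: bit)"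
  shows "length c = n" "(c, unit_vertex n k) \<in> cube_arcs n" "(c, unit_vertex n (Suc k)) \<in> cube_arcs n"
    "(replicate n 0, c) \<notin> cube_arcs n"
proof -
  obtain m where n: "n = m + (Suc (Suc k))" using assms(1)
    by (metis Suc_leI add.commute le_Suc_ex)
  show "length c = n" by (simp add: c_def n)
  have e: "(1 # replicate k 0, 0 # replicate k (0 :: bit)) \<in> cube_arcs (Suc k)"
    by (cases k) (simp_all add: cube_arcs_Cons phi_zero del: replicate_Suc)
  have "(1 # 1 # replicate k 0, 1 # 0 # replicate k 0) \<in> cube_arcs (Suc (Suc k))"
    using e by (simp add: cube_arcs_Cons del: twisted_hypercube.simps)
  from cube_arcs_zero_prefix[OF _ this, of m]
  show "(c, unit_vertex n (Suc k)) \<in> cube_arcs n"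
    by (simp add: c_def n unit_vertex_def)
  have "(1 # 1 # replicate k 0, 0 # 1 # replicate k 0) \<in> cube_arcs (Suc (Suc k))"
    by (simp add: cube_arcs_Cons phi_unit del: twisted_hypercube.simps)
  from cube_arcs_zero_prefix[OF _ this, of m]
  moreover have "unit_vertex n k = replicate m 0 @ 0 # 1 # replicate k 0"
    by (simp add: unit_vertex_def n replicate_app_Cons_same)
  ultimately show "(c, unit_vertex n k) \<in> cube_arcs n"
    by (simp add: c_def n del: twisted_hypercube.simps)
  \<comment> \<open>Every neighbour of the zero word contains a single 1.\<close>
  have "count_list c 1 = 2" by (simp add: c_def)
  moreover have "count_list (unit_vertex n j) 1 = 1" for j by (simp add: unit_vertex_def)
  ultimately show "(replicate n 0, c) \<notin> cube_arcs n"
    using zero_neighbours by (metis numeral_eq_one_iff semiring_norm(85))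
qed

lemma star_covering_units:
  assumes "n \<ge> 4" "2 * i < n"
  shows "\<exists>H. ugraph_subgraph H (twisted_hypercube n) \<and> digraph_iso H (star 3) \<and>
    (\<forall>m < n. m div 2 = i \<longrightarrow> unit_vertex n m \<in> pverts H) \<and>
    replicate n 0 \<notin> pverts H \<and> card (pverts H) = 4"
proof (cases "Suc (2 * i) < n")
  case True
  define c where "c = replicate (n - Suc (Suc (2 * i))) 0 @ 1 # 1 # replicate (2 * i) (0 :: bit)"
  note c = unit_pair_neighbours[OF True, folded c_def]
  let ?R = "{unit_vertex n (2 * i), unit_vertex n (Suc (2 * i))}"
  have nz: "unit_vertex n j \<noteq> replicate n 0" for j
  proof
    assume "unit_vertex n j = replicate n 0"
    moreover have "1 \<in> set (unit_vertex n j)" by (simp add: unit_vertex_def)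
    ultimately show False by simp
  qed
  have "c \<noteq> replicate n 0"
  proof
    assume "c = replicate n 0"
    moreover have "1 \<in> set c" by (simp add: c_def)
    ultimately show False by simp
  qed
  moreover have "card ?R \<le> 3" by (simp add: card_insert_if)
  ultimately obtain H where H: "ugraph_subgraph H (twisted_hypercube n)" "digraph_iso H (star 3)"
    "insert c ?R \<subseteq> pverts H" "replicate n 0 \<notin> pverts H" "card (pverts H) = 4"
    using cube_star_through[OF assms(1) c(1), of "replicate n 0" ?R] c nz by auto
  have "m = 2 * i \<or> m = Suc (2 * i)" if "m div 2 = i" for m using that by linarith
  then show ?thesis using H by blast
next
  case False
  \<comment> \<open>For odd \<open>n\<close> the last unit word has no partner and is itself taken
    as the centre.\<close>
  let ?c = "unit_vertex n (2 * i)"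
  have n: "n = Suc (2 * i)" using False assms(2) by simp
  have "length ?c = n" "?c \<noteq> replicate n 0" by (simp_all add: unit_vertex_def n)
  then obtain H where H: "ugraph_subgraph H (twisted_hypercube n)" "digraph_iso H (star 3)"
    "insert ?c {} \<subseteq> pverts H" "replicate n 0 \<notin> pverts H" "card (pverts H) = 4"
    using cube_star_through[OF assms(1), of ?c "replicate n 0" "{}"] by auto
  have "m = 2 * i" if "m div 2 = i" "m < n" for m using that n by linarith
  then show ?thesis using H by blast
qed

lemma isolating_structure_cut:
  assumes "n \<ge> 4"
  shows "\<exists>F. structure_cut (twisted_hypercube n) (star 3) F \<and> card F \<le> (n + 1) div 2"
proof -
  let ?I = "{..<(n + 1) div 2}" and ?o = "replicate n (0 :: bit)"
  have "\<forall>i \<in> ?I. \<exists>H. ugraph_subgraph H (twisted_hypercube n) \<and> digraph_iso H (star 3) \<and>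
    (\<forall>m < n. m div 2 = i \<longrightarrow> unit_vertex n m \<in> pverts H) \<and> ?o \<notin> pverts H \<and> card (pverts H) = 4"
    using star_covering_units[OF assms] by auto
  from bchoice[OF this] obtain S where
    "\<forall>i \<in> ?I. ugraph_subgraph (S i) (twisted_hypercube n) \<and> digraph_iso (S i) (star 3) \<and>
      (\<forall>m < n. m div 2 = i \<longrightarrow> unit_vertex n m \<in> pverts (S i)) \<and>
      ?o \<notin> pverts (S i) \<and> card (pverts (S i)) = 4" ..
  then have S: "\<And>i. i \<in> ?I \<Longrightarrow> ugraph_subgraph (S i) (twisted_hypercube n)"
    "\<And>i. i \<in> ?I \<Longrightarrow> digraph_iso (S i) (star 3)"
    "\<And>i m. i \<in> ?I \<Longrightarrow> m < n \<Longrightarrow> m div 2 = i \<Longrightarrow> unit_vertex n m \<in> pverts (S i)"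
    "\<And>i. i \<in> ?I \<Longrightarrow> ?o \<notin> pverts (S i)" "\<And>i. i \<in> ?I \<Longrightarrow> card (pverts (S i)) = 4"
    by blast+
  let ?F = "S ` ?I"
  let ?X = "\<Union>H\<in>?F. pverts H"
  let ?G = "delete_family (twisted_hypercube n) ?F"
  let ?V = "cube_verts n - ?X"
  have V: "verts ?G = ?V" by (simp add: delete_family_def pverts_twisted_hypercube)
  have A: "arcs_ends ?G \<subseteq> cube_arcs n"
    by (auto simp: delete_family_def arcs_ends_conv)
  have o: "?o \<in> ?V" using S(4) by auto
  have units: "unit_vertex n m \<in> ?X" if "m < n" for m
  proof -
    have "m div 2 \<in> ?I" using that by auto
    then show ?thesis using S(3)[of "m div 2" m] that by blast
  qed
  \<comment> \<open>A path that leaves the zero word would have to enter a unit word, and all of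
    these are deleted.\<close>
  have isolated: "w = ?o" if "(?o, w) \<in> rtrancl_on ?V ((arcs_ends ?G)\<^sup>s)" for w
    using that
  proof (induction rule: rtrancl_on_induct)
    case (step y z)
    then have "(?o, z) \<in> cube_arcs n"
      using A symD[OF sym_cube_arcs] by (auto simp: symcl_def)
    then obtain m where "m < n" "z = unit_vertex n m" using zero_neighbours by metis
    then have "z \<in> ?X" using units by simp
    then show ?case using step.hyps by blast
  qed simp
  \<comment> \<open>Isolation disconnects only if another vertex survives: at most
    \<open>2 * n + 2\<close> vertices are deleted, fewer than \<open>2 ^ n - 1\<close>.\<close>
  have "card ?X \<le> (\<Sum>i\<in>?I. card (pverts (S i)))"
    using card_UN_le[of ?I "\<lambda>i. pverts (S i)"] by simp
  also have "\<dots> = 4 * ((n + 1) div 2)" using S(5) by simp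
  also have "\<dots> < 2 ^ n - 1"
  proof -
    have "2 * n + 3 < (2 :: nat) ^ n"
      using assms by (induction n rule: nat_induct_at_least) auto
    then show ?thesis by linarith
  qed
  finally have "card ?X < 2 ^ n - 1" .
  then have "card (insert ?o ?X) < card (cube_verts n)"
    using card_Un_le[of "{?o}" ?X] card_cube_verts[of n] by simp
  moreover have "finite (insert ?o ?X)"
    using S(5) by (auto intro!: finite_UN_I card_ge_0_finite)
  ultimately have "\<not> cube_verts n \<subseteq> insert ?o ?X"
    using card_mono[of "insert ?o ?X" "cube_verts n"] by linarith
  then obtain w where w: "w \<in> ?V" "w \<noteq> ?o" by blast
  then have "(?o, w) \<notin> rtrancl_on ?V ((arcs_ends ?G)\<^sup>s)" using isolated[of w] by argo
  then have "\<not> connected ?G" using o w(1) unfolding connected_conv V by metis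
  then have "disconnected_graph ?G" unfolding disconnected_graph_def V using o by blast
  then have "structure_cut (twisted_hypercube n) (star 3) ?F"
    using S(1,2) unfolding structure_cut_def by blast
  moreover have "card ?F \<le> (n + 1) div 2" using card_image_le[of ?I S] by simp
  ultimately show ?thesis by blast
qed

section \<open>Both connectivity numbers\<close>

lemma nat_ceiling_half: "nat \<lceil>real n / 2\<rceil> = (n + 1) div 2"
proof -
  have "\<lceil>real n / 2\<rceil> = int ((n + 1) div 2)"
    by (rule ceiling_unique) linarith+
  then show ?thesis by simp
qed

theorem theorem3p7:
  fixes n :: nat
  assumes "n \<ge> 4"
  shows "structure_connectivity (twisted_hypercube n) (star 3) = enat (nat \<lceil>real n / 2\<rceil>)
    \<and> substructure_connectivity (twisted_hypercube n) (star 3) = enat (nat \<lceil>real n / 2\<rceil>)"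
proof -
  let ?G = "twisted_hypercube n" and ?k = "(n + 1) div 2"
  obtain F where F: "structure_cut ?G (star 3) F" "card F \<le> ?k"
    using isolating_structure_cut[OF assms] by blast
  note sub = structure_cut_imp_substructure_cut
  \<comment> \<open>Structure cuts are substructure cuts, so this lower bound and the single cut
    \<open>F\<close> settle both minima.\<close>
  have lower: "enat ?k \<le> enat (card F')" if "substructure_cut ?G (star 3) F'" for F'
    using substructure_cut_star_card[OF _ that] assms by simp
  have "structure_connectivity ?G (star 3) = enat ?k"
    unfolding structure_connectivity_def
  proof (rule antisym)
    show "(INF F \<in> {F. structure_cut ?G (star 3) F}. enat (card F)) \<le> enat ?k"
      by (rule INF_lower2[of F]) (use F in auto)
  qed (use lower sub in \<open>blast intro: INF_greatest\<close>)
  moreover have "substructure_connectivity ?G (star 3) = enat ?k"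
    unfolding substructure_connectivity_def
  proof (rule antisym)
    show "(INF F \<in> {F. substructure_cut ?G (star 3) F}. enat (card F)) \<le> enat ?k"
      by (rule INF_lower2[of F]) (use F sub in auto)
  qed (use lower in \<open>blast intro: INF_greatest\<close>)
  ultimately show ?thesis by (simp add: nat_ceiling_half)
qed

end
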